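(* Let $G$ be a nontrivial finite group and let $\mathsf{L}_G=\{(x,y,xy): x,y\in G\}\subset G\times G\times G$ be its multiplication table. Then $\mathsf{L}_G$ is $\mathcal{A}$-quasirandom with parameter $1/D$, where $D$ is the minimal dimension of a nontrivial complex linear representation of $G$.
   Context: For a latin square $\mathsf{L}\subset X\times Y\times Z$ of order $n$ (every pair in $X\times Y$, $Y\times Z$, $Z\times X$ lies in exactly one triple), define $\mathcal{A}$ on functions $f:X\times Y\to\mathbf{C}$ by $\mathcal{A}f(x,y)=\frac1n\sum_{z\in Z}f(x',y')$, where $x',y'$ are the unique elements with $(x,y',z),(x',y,z)\in\mathsf{L}$, and $\mathcal{U}f(x,y)=\frac1{n^2}\sum_{x',y'}f(x',y')$. $\mathsf{L}$ is $\mathcal{A}$-quasirandom with parameter $\rho$ if the spectral radius of $\mathcal{A}-\mathcal{U}$ is at most $\rho$. Here $X=Y=Z=G$ and $n=|G|$. *)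

theory Defs
  imports Complex_Main "HOL-Algebra.Group" "Jordan_Normal_Form.Matrix"
begin

definition latin_square ::
  "nat \<Rightarrow> 'x set \<Rightarrow> 'y set \<Rightarrow> 'z set \<Rightarrow> ('x \<times> 'y \<times> 'z) set \<Rightarrow> bool" where
  "latin_square n X Y Z L \<longleftrightarrow>
     finite X \<and> finite Y \<and> finite Z \<and> card X = n \<and> card Y = n \<and> card Z = n \<and>
     L \<subseteq> X \<times> Y \<times> Z \<and>
     (\<forall>x\<in>X. \<forall>y\<in>Y. \<exists>!z. (x, y, z) \<in> L) \<and>
     (\<forall>y\<in>Y. \<forall>z\<in>Z. \<exists>!x. (x, y, z) \<in> L) \<and>
     (\<forall>z\<in>Z. \<forall>x\<in>X. \<exists>!y. (x, y, z) \<in> L)"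

text \<open>
  A complex function on \<open>X \<times> Y\<close> is represented by a function on the whole product type of which
  only the values on \<open>X \<times> Y\<close> matter. On \<open>X \<times> Y\<close>, the operators below only read values
  of their argument on \<open>X \<times> Y\<close> (when \<open>L\<close> is a latin square).
\<close>

definition op_A ::
  "nat \<Rightarrow> 'z set \<Rightarrow> ('x \<times> 'y \<times> 'z) set \<Rightarrow> ('x \<times> 'y \<Rightarrow> complex) \<Rightarrow> ('x \<times> 'y \<Rightarrow> complex)" where
  "op_A n Z L f = (\<lambda>(x, y).
     (\<Sum>z\<in>Z. f (THE x'. (x', y, z) \<in> L, THE y'. (x, y', z) \<in> L)) / of_nat n)"

definition op_U ::
  "nat \<Rightarrow> 'x set \<Rightarrow> 'y set \<Rightarrow> ('x \<times> 'y \<Rightarrow> complex) \<Rightarrow> ('x \<times> 'y \<Rightarrow> complex)" where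
  "op_U n X Y f = (\<lambda>_. (\<Sum>x'\<in>X. \<Sum>y'\<in>Y. f (x', y')) / (of_nat n)\<^sup>2)"

text \<open>
  The spectrum of a linear operator \<open>T\<close> on the space of complex functions on a finite set \<open>S\<close>,
  that is, the set of its eigenvalues. Both equality and being nonzero refer to the values on \<open>S\<close>.
\<close>

definition op_spectrum ::
  "'p set \<Rightarrow> (('p \<Rightarrow> complex) \<Rightarrow> ('p \<Rightarrow> complex)) \<Rightarrow> complex set" where
  "op_spectrum S T = {\<mu>. \<exists>f. (\<exists>p\<in>S. f p \<noteq> 0) \<and> (\<forall>p\<in>S. T f p = \<mu> * f p)}"

definition op_spectral_radius ::
  "'p set \<Rightarrow> (('p \<Rightarrow> complex) \<Rightarrow> ('p \<Rightarrow> complex)) \<Rightarrow> real" where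
  "op_spectral_radius S T = (SUP \<mu>\<in>op_spectrum S T. cmod \<mu>)"

definition A_quasirandom ::
  "nat \<Rightarrow> 'x set \<Rightarrow> 'y set \<Rightarrow> 'z set \<Rightarrow> ('x \<times> 'y \<times> 'z) set \<Rightarrow> real \<Rightarrow> bool" where
  "A_quasirandom n X Y Z L \<rho> \<longleftrightarrow>
     latin_square n X Y Z L \<and>
     op_spectral_radius (X \<times> Y) (\<lambda>f p. op_A n Z L f p - op_U n X Y f p) \<le> \<rho>"

definition mult_table :: "('a, 'b) monoid_scheme \<Rightarrow> ('a \<times> 'a \<times> 'a) set" where
  "mult_table G = {(x, y, x \<otimes>\<^bsub>G\<^esub> y) | x y. x \<in> carrier G \<and> y \<in> carrier G}"

definition complex_GL :: "nat \<Rightarrow> complex mat monoid" where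
  "complex_GL d = units_of (ring_mat TYPE(complex) d ())"

text \<open>
  A representation is nontrivial if some group element does not act as the identity; in
  particular, a zero-dimensional representation is trivial.
\<close>

definition nontrivial_rep ::
  "('a, 'b) monoid_scheme \<Rightarrow> nat \<Rightarrow> ('a \<Rightarrow> complex mat) \<Rightarrow> bool" where
  "nontrivial_rep G d \<phi> \<longleftrightarrow>
     \<phi> \<in> hom G (complex_GL d) \<and> (\<exists>g\<in>carrier G. \<phi> g \<noteq> \<one>\<^bsub>complex_GL d\<^esub>)"

definition min_nontrivial_rep_dim :: "('a, 'b) monoid_scheme \<Rightarrow> nat" where
  "min_nontrivial_rep_dim G = (LEAST d. \<exists>\<phi>. nontrivial_rep G d \<phi>)"

end

theory Submission
  imports Defs "Jordan_Normal_Form.Spectral_Radius"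
begin

text \<open>
  Substituting \<open>z = x u y\<close> turns the operator \<open>A\<close> of the multiplication table into the average over \<open>u\<close>
  of \<open>f (x u, u y)\<close>. If \<open>f\<close> is an eigenfunction of \<open>A - U\<close> with eigenvalue \<open>\<mu> \<noteq> 0\<close>, then \<open>f\<close> has sum
  zero and is an eigenfunction of \<open>A\<close>. Choose \<open>y\<^sub>0\<close> with \<open>f (\<cdot>, y\<^sub>0) \<noteq> 0\<close> and a representation \<open>\<sigma>\<close> of
  minimal dimension \<open>d\<close> at which the Fourier transform of \<open>f (\<cdot>, y\<^sub>0)\<close> does not vanish. Minimality
  forces Schur's lemma for \<open>\<sigma>\<close>, hence the orthogonality relations of its matrix coefficients. In the
  block of \<open>\<sigma>\<close> these turn \<open>A\<close> into \<open>1 / d\<close> times an index swap, so that \<open>\<bar>\<mu>\<bar> = 1 / d\<close>. Finally \<open>\<sigma>\<close>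
  is nontrivial because \<open>f\<close> has sum zero.
\<close>

section \<open>Rank factorization of complex matrices\<close>

text \<open>Since \<open>v $ k\<close> is nonzero, \<open>B *\<^sub>v v = 0\<close> expresses column
  \<open>k\<close> of \<open>B\<close> through the other columns. Hence a factor with a nontrivial
  kernel can be replaced by one with fewer columns, which is what makes a shortest factorization
  have full rank.\<close>

lemma factor_through_kernel_vector:
  fixes B :: "'a :: field mat"
  assumes B: "B \<in> carrier_mat m r" and v: "v \<in> carrier_vec r" "v \<noteq> 0\<^sub>v r" "B *\<^sub>v v = 0\<^sub>v m"
  obtains P Q where "P \<in> carrier_mat m (r - 1)" "Q \<in> carrier_mat (r - 1) r" "B = P * Q" "0 < r"
proof -
  obtain k where k: "k < r" and vk: "v $ k \<noteq> 0"
    using v(1,2) by (auto simp: vec_eq_iff)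
  let ?s = "insert_index k"
  \<comment> \<open>\<open>q l' l\<close> is the coefficient of column \<open>l'\<close> in the
    expression of column \<open>l\<close> by the columns other than \<open>k\<close>;
    \<open>P\<close> is \<open>B\<close> without column \<open>k\<close>.\<close>
  define q where "q l' l = (if l = k then - v $ l' / v $ k else of_bool (l' = l))" for l' l
  define P where "P = mat m (r - 1) (\<lambda>(i, j). B $$ (i, ?s j))"
  define Q where "Q = mat (r - 1) r (\<lambda>(j, l). q (?s j) l)"
  have img: "?s ` {0..<r - 1} = {0..<r} - {k}"
    using insert_index_image[of k "r - 1"] k by simp
  have "B = P * Q"
  proof (rule eq_matI)
    fix i l assume "i < dim_row (P * Q)" "l < dim_col (P * Q)"
    then have i: "i < m" and l: "l < r" by (auto simp: P_def Q_def)
    have "(P * Q) $$ (i, l) = (\<Sum>j\<in>{0..<r-1}. B $$ (i, ?s j) * q (?s j) l)"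
      using i l by (simp add: P_def Q_def scalar_prod_def)
    also have "\<dots> = (\<Sum>l'\<in>{0..<r} - {k}. B $$ (i, l') * q l' l)"
      unfolding img[symmetric] by (subst sum.reindex) (auto simp: insert_index_inj_on)
    also have "\<dots> = B $$ (i, l)"
    proof (cases "l = k")
      case False
      then have "(\<Sum>l'\<in>{0..<r} - {k}. B $$ (i, l') * q l' l)
          = (\<Sum>l'\<in>{0..<r} - {k}. if l' = l then B $$ (i, l') else 0)"
        by (intro sum.cong) (auto simp: q_def)
      also have "\<dots> = B $$ (i, l)" using l False by simp
      finally show ?thesis .
    next
      case True
      have "(\<Sum>l'\<in>{0..<r}. B $$ (i, l') * v $ l') = (B *\<^sub>v v) $ i"
        using B v(1) i by (simp add: scalar_prod_def)
      also have "\<dots> = 0" using v(3) i by simp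
      finally have "(\<Sum>l'\<in>{0..<r} - {k}. B $$ (i, l') * v $ l') = - (B $$ (i, k) * v $ k)"
        using k by (simp add: sum_diff1)
      moreover have "(\<Sum>l'\<in>{0..<r} - {k}. B $$ (i, l') * q l' l)
          = - (\<Sum>l'\<in>{0..<r} - {k}. B $$ (i, l') * v $ l') / v $ k"
        using True by (simp add: q_def sum_divide_distrib sum_negf)
      ultimately show ?thesis using vk True by simp
    qed
    finally show "B $$ (i, l) = (P * Q) $$ (i, l)" by simp
  qed (use B in \<open>auto simp: P_def Q_def\<close>)
  moreover have "P \<in> carrier_mat m (r - 1)" "Q \<in> carrier_mat (r - 1) r" "0 < r"
    using k by (auto simp: P_def Q_def)
  ultimately show thesis using that by blast
qed

text \<open>With \<open>H\<close> the conjugate transpose of \<open>B\<close>, the Gram matrix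
  \<open>H * B\<close> is injective: if \<open>H * B\<close> kills \<open>v\<close>, then the
  squared norm of \<open>B *\<^sub>v v\<close> is zero. So it has an inverse \<open>N\<close>, and
  \<open>N * H\<close> is a left inverse of \<open>B\<close>.\<close>

lemma injective_mat_left_inverse:
  fixes B :: "complex mat"
  assumes B: "B \<in> carrier_mat m r"
    and inj: "\<And>v. v \<in> carrier_vec r \<Longrightarrow> B *\<^sub>v v = 0\<^sub>v m \<Longrightarrow> v = 0\<^sub>v r"
  obtains B' where "B' \<in> carrier_mat r m" "B' * B = 1\<^sub>m r"
proof -
  define H where "H = mat r m (\<lambda>(j, i). cnj (B $$ (i, j)))"
  have H: "H \<in> carrier_mat r m" by (simp add: H_def)
  have "v = 0\<^sub>v r" if v: "v \<in> carrier_vec r" and 0: "(H * B) *\<^sub>v v = 0\<^sub>v r" for v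
  proof -
    define w where "w = B *\<^sub>v v"
    have w: "w \<in> carrier_vec m" using B v by (simp add: w_def)
    have Hw: "H *\<^sub>v w = 0\<^sub>v r" using 0 assoc_mult_mat_vec[OF H B v] by (simp add: w_def)
    have "w \<bullet>c w = (\<Sum>i<m. w $ i * cnj (w $ i))"
      using w by (auto simp: scalar_prod_def conjugate_complex_def atLeast0LessThan)
    also have "\<dots> = (\<Sum>i<m. \<Sum>j<r. cnj (v $ j) * (H $$ (j, i) * w $ i))"
    proof (rule sum.cong[OF refl])
      fix i assume i: "i \<in> {..<m}"
      have "w $ i = (\<Sum>j<r. B $$ (i, j) * v $ j)"
        using i B v by (simp add: w_def scalar_prod_def atLeast0LessThan)
      then have "cnj (w $ i) = (\<Sum>j<r. H $$ (j, i) * cnj (v $ j))"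
        using i by (simp add: H_def)
      then show "w $ i * cnj (w $ i) = (\<Sum>j<r. cnj (v $ j) * (H $$ (j, i) * w $ i))"
        by (simp add: sum_distrib_left mult_ac)
    qed
    also have "\<dots> = (\<Sum>j<r. cnj (v $ j) * (\<Sum>i<m. H $$ (j, i) * w $ i))"
      by (subst sum.swap) (simp add: sum_distrib_left)
    also have "\<dots> = (\<Sum>j<r. cnj (v $ j) * (H *\<^sub>v w) $ j)"
      using w H by (auto intro!: sum.cong simp: scalar_prod_def atLeast0LessThan)
    also have "\<dots> = 0" by (simp add: Hw)
    finally have "w = 0\<^sub>v m" using w by simp
    then show ?thesis using inj v by (simp add: w_def)
  qed
  then have "det (H * B) \<noteq> 0"
    using det_0_iff_vec_prod_zero_field[of "H * B" r] H B by auto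
  then have "H * B \<in> Units (ring_mat TYPE(complex) r ())"
    using det_non_zero_imp_unit[of "H * B" r] H B by auto
  then obtain N where N: "N \<in> carrier_mat r r" "N * (H * B) = 1\<^sub>m r"
    by (auto simp: Units_def ring_mat_def)
  show thesis using that[of "N * H"] N H B by (simp add: assoc_mult_mat[of _ r r _ m])
qed

text \<open>Take the least possible inner dimension \<open>r\<close>. A kernel vector of
  \<open>B\<close> or of the transpose of \<open>C\<close> would shorten the factorization, so both
  are injective and have left inverses; transposing the second one gives \<open>C'\<close>. A kernel
  vector of \<open>S\<close> itself yields a factorization through \<open>d - 1\<close>.\<close>

lemma full_rank_factorization:
  fixes S :: "complex mat"
  assumes S: "S \<in> carrier_mat d d"
  obtains r B C B' C' where
    "B \<in> carrier_mat d r" "C \<in> carrier_mat r d" "B' \<in> carrier_mat r d" "C' \<in> carrier_mat d r"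
    "S = B * C" "B' * B = 1\<^sub>m r" "C * C' = 1\<^sub>m r"
    "det S = 0 \<longrightarrow> r < d"
proof -
  define \<F> where "\<F> r \<longleftrightarrow> (\<exists>B C. B \<in> carrier_mat d r \<and> C \<in> carrier_mat r d \<and> S = B * C)" for r
  define r where "r = (LEAST r. \<F> r)"
  have d: "\<F> d" unfolding \<F>_def by (rule exI[of _ S], rule exI[of _ "1\<^sub>m d"]) (use S in simp)
  then have "\<F> r" unfolding r_def by (rule LeastI)
  then obtain B C where B: "B \<in> carrier_mat d r" and C: "C \<in> carrier_mat r d" and BC: "S = B * C"
    by (auto simp: \<F>_def)
  have min: "\<not> \<F> (r - 1)" if "0 < r"
    unfolding r_def by (rule not_less_Least) (use that r_def in simp)
  have B0: "v = 0\<^sub>v r" if v: "v \<in> carrier_vec r" "B *\<^sub>v v = 0\<^sub>v d" for v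
  proof (rule ccontr)
    assume "v \<noteq> 0\<^sub>v r"
    from factor_through_kernel_vector[OF B v(1) this v(2)] obtain P Q
      where PQ: "P \<in> carrier_mat d (r - 1)" "Q \<in> carrier_mat (r - 1) r" "B = P * Q" "0 < r" .
    then have "S = P * (Q * C)" "Q * C \<in> carrier_mat (r - 1) d" using BC C by auto
    then show False using min PQ(1,4) unfolding \<F>_def by blast
  qed
  have C0: "v = 0\<^sub>v r" if v: "v \<in> carrier_vec r" "C\<^sup>T *\<^sub>v v = 0\<^sub>v d" for v
  proof (rule ccontr)
    assume "v \<noteq> 0\<^sub>v r"
    from factor_through_kernel_vector[OF _ v(1) this v(2)] C obtain P Q
      where PQ: "P \<in> carrier_mat d (r - 1)" "Q \<in> carrier_mat (r - 1) r" "C\<^sup>T = P * Q" "0 < r"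
      by auto
    then have "C = Q\<^sup>T * P\<^sup>T" using transpose_mult[OF PQ(1,2)] by (metis transpose_transpose)
    then have "S = (B * Q\<^sup>T) * P\<^sup>T" using BC B PQ by simp
    moreover have "B * Q\<^sup>T \<in> carrier_mat d (r - 1)" "P\<^sup>T \<in> carrier_mat (r - 1) d"
      using PQ B by auto
    ultimately show False using min PQ(4) unfolding \<F>_def by blast
  qed
  obtain B' where B': "B' \<in> carrier_mat r d" "B' * B = 1\<^sub>m r"
    by (rule injective_mat_left_inverse[OF B B0])
  obtain D where D: "D \<in> carrier_mat r d" "D * C\<^sup>T = 1\<^sub>m r"
    by (rule injective_mat_left_inverse[OF _ C0]) (use C in auto)
  have CD: "C * D\<^sup>T = 1\<^sub>m r"
    using arg_cong[OF D(2), of transpose_mat] transpose_mult[of D r d "C\<^sup>T" r] D(1) C by simp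
  have less: "det S = 0 \<longrightarrow> r < d"
  proof
    assume "det S = 0"
    then obtain v where v: "v \<in> carrier_vec d" "v \<noteq> 0\<^sub>v d" "S *\<^sub>v v = 0\<^sub>v d"
      using det_0_iff_vec_prod_zero_field[OF S] by auto
    from factor_through_kernel_vector[OF S v] obtain P Q
      where PQ: "P \<in> carrier_mat d (d - 1)" "Q \<in> carrier_mat (d - 1) d" "S = P * Q" "0 < d" .
    then have "\<F> (d - 1)" unfolding \<F>_def by blast
    then have "r \<le> d - 1" unfolding r_def by (rule Least_le)
    then show "r < d" using PQ(4) by simp
  qed
  have "D\<^sup>T \<in> carrier_mat d r" using D(1) by simp
  from that[OF B C B'(1) this BC B'(2) CD less] show thesis .
qed

section \<open>Linear combinations of matrices\<close>

text \<open>The dimensions are arguments, so that even an empty sum has the intended shape. Group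
  averages and Fourier transforms are both instances.\<close>

definition weighted_sum ::
  "'i set \<Rightarrow> nat \<Rightarrow> nat \<Rightarrow> ('i \<Rightarrow> 'b) \<Rightarrow> ('i \<Rightarrow> 'b mat) \<Rightarrow> 'b :: comm_ring_1 mat" where
  "weighted_sum I m k c M = mat m k (\<lambda>(i, j). \<Sum>x\<in>I. c x * M x $$ (i, j))"

lemma weighted_sum_carrier [simp]: "weighted_sum I m k c M \<in> carrier_mat m k"
  by (simp add: weighted_sum_def)

lemma weighted_sum_index:
  "i < m \<Longrightarrow> j < k \<Longrightarrow> weighted_sum I m k c M $$ (i, j) = (\<Sum>x\<in>I. c x * M x $$ (i, j))"
  by (simp add: weighted_sum_def)

lemma weighted_sum_cong:
  assumes "\<And>x. x \<in> I \<Longrightarrow> M x = N x"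
  shows "weighted_sum I m k c M = weighted_sum I m k c N"
  unfolding weighted_sum_def using assms by (auto intro!: cong_mat sum.cong)

lemma weighted_sum_mult_right:
  assumes M: "\<And>x. x \<in> I \<Longrightarrow> M x \<in> carrier_mat m k" and B: "B \<in> carrier_mat k l"
  shows "weighted_sum I m k c M * B = weighted_sum I m l c (\<lambda>x. M x * B)"
proof (rule eq_matI)
  fix i j assume "i < dim_row (weighted_sum I m l c (\<lambda>x. M x * B))"
    "j < dim_col (weighted_sum I m l c (\<lambda>x. M x * B))"
  then have i: "i < m" and j: "j < l" by (auto simp: weighted_sum_def)
  have "(weighted_sum I m k c M * B) $$ (i, j)
      = (\<Sum>h = 0..<k. \<Sum>x\<in>I. c x * M x $$ (i, h) * B $$ (h, j))"
    using i j B by (simp add: weighted_sum_def scalar_prod_def sum_distrib_right)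
  also have "\<dots> = (\<Sum>x\<in>I. c x * (\<Sum>h = 0..<k. M x $$ (i, h) * B $$ (h, j)))"
    by (subst sum.swap) (simp add: sum_distrib_left mult.assoc)
  also have "\<dots> = (\<Sum>x\<in>I. c x * (M x * B) $$ (i, j))"
  proof (rule sum.cong[OF refl])
    fix x assume "x \<in> I"
    from M[OF this] show "c x * (\<Sum>h = 0..<k. M x $$ (i, h) * B $$ (h, j)) = c x * (M x * B) $$ (i, j)"
      using i j B by (simp add: scalar_prod_def)
  qed
  finally show "(weighted_sum I m k c M * B) $$ (i, j) = weighted_sum I m l c (\<lambda>x. M x * B) $$ (i, j)"
    using i j by (simp add: weighted_sum_index)
qed (use B in \<open>auto simp: weighted_sum_def\<close>)

lemma weighted_sum_mult_left:
  assumes M: "\<And>x. x \<in> I \<Longrightarrow> M x \<in> carrier_mat k l" and B: "B \<in> carrier_mat m k"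
  shows "B * weighted_sum I k l c M = weighted_sum I m l c (\<lambda>x. B * M x)"
proof (rule eq_matI)
  fix i j assume "i < dim_row (weighted_sum I m l c (\<lambda>x. B * M x))"
    "j < dim_col (weighted_sum I m l c (\<lambda>x. B * M x))"
  then have i: "i < m" and j: "j < l" by (auto simp: weighted_sum_def)
  have "(B * weighted_sum I k l c M) $$ (i, j)
      = (\<Sum>h = 0..<k. \<Sum>x\<in>I. c x * (B $$ (i, h) * M x $$ (h, j)))"
    using i j B by (simp add: weighted_sum_def scalar_prod_def sum_distrib_left mult.left_commute)
  also have "\<dots> = (\<Sum>x\<in>I. c x * (\<Sum>h = 0..<k. B $$ (i, h) * M x $$ (h, j)))"
    by (subst sum.swap) (simp add: sum_distrib_left)
  also have "\<dots> = (\<Sum>x\<in>I. c x * (B * M x) $$ (i, j))"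
  proof (rule sum.cong[OF refl])
    fix x assume "x \<in> I"
    from M[OF this] show "c x * (\<Sum>h = 0..<k. B $$ (i, h) * M x $$ (h, j)) = c x * (B * M x) $$ (i, j)"
      using i j B by (simp add: scalar_prod_def)
  qed
  finally show "(B * weighted_sum I k l c M) $$ (i, j) = weighted_sum I m l c (\<lambda>x. B * M x) $$ (i, j)"
    using i j by (simp add: weighted_sum_index)
qed (use B in \<open>auto simp: weighted_sum_def\<close>)

section \<open>Matrix representations of a finite group and averaging\<close>

locale finite_group = group +
  assumes finite_carrier: "finite (carrier G)"
begin

text \<open>The value at \<open>\<one>\<close> stands in for invertibility: with multiplicativity it
  makes \<open>\<sigma> g\<close> and \<open>\<sigma> (inv g)\<close> mutually inverse.\<close>

definition matrix_rep :: "nat \<Rightarrow> ('a \<Rightarrow> complex mat) \<Rightarrow> bool" where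
  "matrix_rep d \<sigma> \<longleftrightarrow> \<sigma> \<one> = 1\<^sub>m d \<and> (\<forall>g\<in>carrier G. \<sigma> g \<in> carrier_mat d d) \<and>
     (\<forall>g\<in>carrier G. \<forall>h\<in>carrier G. \<sigma> (g \<otimes> h) = \<sigma> g * \<sigma> h)"

lemma matrix_repD:
  assumes "matrix_rep d \<sigma>"
  shows "\<sigma> \<one> = 1\<^sub>m d" "\<And>g. g \<in> carrier G \<Longrightarrow> \<sigma> g \<in> carrier_mat d d"
    "\<And>g h. g \<in> carrier G \<Longrightarrow> h \<in> carrier G \<Longrightarrow> \<sigma> (g \<otimes> h) = \<sigma> g * \<sigma> h"
    "\<And>g. g \<in> carrier G \<Longrightarrow> \<sigma> g * \<sigma> (inv g) = 1\<^sub>m d"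
    "\<And>g. g \<in> carrier G \<Longrightarrow> \<sigma> (inv g) * \<sigma> g = 1\<^sub>m d"
proof -
  show 1: "\<sigma> \<one> = 1\<^sub>m d" "\<And>g. g \<in> carrier G \<Longrightarrow> \<sigma> g \<in> carrier_mat d d"
    and m: "\<And>g h. g \<in> carrier G \<Longrightarrow> h \<in> carrier G \<Longrightarrow> \<sigma> (g \<otimes> h) = \<sigma> g * \<sigma> h"
    using assms by (auto simp: matrix_rep_def)
  show "\<sigma> g * \<sigma> (inv g) = 1\<^sub>m d" if "g \<in> carrier G" for g
    using m[of g "inv g"] that 1(1) by simp
  show "\<sigma> (inv g) * \<sigma> g = 1\<^sub>m d" if "g \<in> carrier G" for g
    using m[of "inv g" g] that 1(1) by simp
qed

definition avg :: "nat \<Rightarrow> ('a \<Rightarrow> complex mat) \<Rightarrow> complex mat \<Rightarrow> complex mat" where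
  "avg d \<sigma> X = weighted_sum (carrier G) d d (\<lambda>_. 1 / of_nat (card (carrier G))) (\<lambda>u. \<sigma> u * X * \<sigma> (inv u))"

lemma avg_carrier [simp]: "avg d \<sigma> X \<in> carrier_mat d d"
  by (simp add: avg_def)

lemma card_carrier_nonzero: "card (carrier G) \<noteq> 0"
  using finite_carrier by auto

lemma sum_carrier_left_translate:
  assumes "g \<in> carrier G"
  shows "(\<Sum>u\<in>carrier G. f (g \<otimes> u)) = (\<Sum>u\<in>carrier G. f u)"
  by (rule sum.reindex_bij_witness[of _ "\<lambda>u. inv g \<otimes> u" "\<lambda>u. g \<otimes> u"])
     (use assms in \<open>auto simp: m_assoc[symmetric]\<close>)

lemma sum_carrier_right_translate:
  assumes "g \<in> carrier G"
  shows "(\<Sum>u\<in>carrier G. f (u \<otimes> g)) = (\<Sum>u\<in>carrier G. f u)"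
  by (rule sum.reindex_bij_witness[of _ "\<lambda>u. u \<otimes> inv g" "\<lambda>u. u \<otimes> g"])
     (use assms in \<open>auto simp: m_assoc\<close>)

text \<open>Replacing \<open>u\<close> by \<open>g \<otimes> u\<close> in the average turns the
  right factor \<open>\<sigma> g\<close> into a left one, because
  \<open>inv (g \<otimes> u) \<otimes> g = inv u\<close>.\<close>

lemma avg_commute:
  assumes \<sigma>: "matrix_rep d \<sigma>" and X: "X \<in> carrier_mat d d" and g: "g \<in> carrier G"
  shows "\<sigma> g * avg d \<sigma> X = avg d \<sigma> X * \<sigma> g"
proof -
  note [simp] = matrix_repD[OF \<sigma>] assoc_mult_mat[of _ d d _ d _ d] mult_carrier_mat[of _ d d _ d]
    right_mult_one_mat[of _ d d]
  let ?N = "\<lambda>u. \<sigma> u * X * \<sigma> (inv u) * \<sigma> g"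
  have "avg d \<sigma> X * \<sigma> g = weighted_sum (carrier G) d d (\<lambda>_. 1 / of_nat (card (carrier G))) ?N"
    unfolding avg_def by (rule weighted_sum_mult_right) (use X g in auto)
  also have "\<dots> = weighted_sum (carrier G) d d (\<lambda>_. 1 / of_nat (card (carrier G))) (\<lambda>u. ?N (g \<otimes> u))"
    unfolding weighted_sum_def
    by (intro cong_mat refl, simp only: split,
        rule sum_carrier_left_translate[OF g, where f = "\<lambda>u. 1 / of_nat (card (carrier G)) * ?N u $$ _", symmetric])
  also have "\<dots> = weighted_sum (carrier G) d d (\<lambda>_. 1 / of_nat (card (carrier G))) (\<lambda>u. \<sigma> g * (\<sigma> u * X * \<sigma> (inv u)))"
    by (rule weighted_sum_cong) (use X g in \<open>simp add: inv_mult_group\<close>)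
  also have "\<dots> = \<sigma> g * avg d \<sigma> X"
    unfolding avg_def by (rule weighted_sum_mult_left[symmetric]) (use X g in auto)
  finally show ?thesis ..
qed

section \<open>Fourier transforms and Schur's lemma by minimality\<close>

definition fourier :: "nat \<Rightarrow> ('a \<Rightarrow> complex) \<Rightarrow> ('a \<Rightarrow> complex mat) \<Rightarrow> complex mat" where
  "fourier d c \<sigma> = weighted_sum (carrier G) d d c \<sigma>"

lemma fourier_carrier [simp]: "fourier d c \<sigma> \<in> carrier_mat d d"
  by (simp add: fourier_def)

text \<open>The image of \<open>S\<close> is an invariant subspace of dimension
  \<open>r < d\<close>. By minimality the Fourier transform vanishes on the subrepresentation it
  carries, so \<open>fourier d c \<sigma>\<close> kills the columns of \<open>B\<close> and
  therefore \<open>S = B * C\<close>.\<close>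

lemma fourier_mult_commuting_singular:
  assumes \<sigma>: "matrix_rep d \<sigma>"
    and min: "\<forall>r<d. \<forall>\<rho>. matrix_rep r \<rho> \<longrightarrow> fourier r c \<rho> = 0\<^sub>m r r"
    and S: "S \<in> carrier_mat d d" "\<forall>g\<in>carrier G. \<sigma> g * S = S * \<sigma> g"
    and v: "v \<in> carrier_vec d" "v \<noteq> 0\<^sub>v d" "S *\<^sub>v v = 0\<^sub>v d"
  shows "fourier d c \<sigma> * S = 0\<^sub>m d d"
proof -
  obtain r B C B' C' where car: "B \<in> carrier_mat d r" "C \<in> carrier_mat r d"
      "B' \<in> carrier_mat r d" "C' \<in> carrier_mat d r"
    and SBC: "S = B * C" and BB: "B' * B = 1\<^sub>m r" and CC: "C * C' = 1\<^sub>m r"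
    and r: "det S = 0 \<longrightarrow> r < d"
    by (rule full_rank_factorization[OF S(1)]) (rule that, assumption+)
  have "r < d" using r v det_0_iff_vec_prod_zero_field[OF S(1)] by blast
  note rep = matrix_repD[OF \<sigma>]
  \<comment> \<open>the action of \<open>\<sigma>\<close> on the image of \<open>S\<close>, in the basis given by the columns of \<open>B\<close>\<close>
  define \<rho> where "\<rho> g = C * \<sigma> g * C'" for g
  have \<rho>car: "\<rho> g \<in> carrier_mat r r" if "g \<in> carrier G" for g
    using car rep(2)[OF that] by (auto simp: \<rho>_def)
  \<comment> \<open>\<open>B * C\<close> is \<open>S\<close>, which moves past
    \<open>\<sigma> g\<close>; then \<open>C * C' = 1\<close> leaves only \<open>B\<close>.
    Identities for \<open>\<rho>\<close> are later checked after multiplication by \<open>B\<close>,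
    which \<open>B'\<close> undoes.\<close>
  have inter: "\<sigma> g * B = B * \<rho> g" if g: "g \<in> carrier G" for g
  proof -
    note gc = rep(2)[OF g]
    have "B * \<rho> g = S * \<sigma> g * C'"
      unfolding \<rho>_def SBC using car gc
      by (simp add: assoc_mult_mat[of _ d r _ d _ d] assoc_mult_mat[of _ d r _ d _ r]
          assoc_mult_mat[of _ r d _ d _ r])
    also have "\<dots> = \<sigma> g * (B * (C * C'))"
      unfolding S(2)[rule_format, OF g, symmetric] unfolding SBC using car gc
      by (simp add: assoc_mult_mat[of _ d d _ d _ r] assoc_mult_mat[of _ d r _ d _ r])
    finally show ?thesis using car CC by simp
  qed
  have cancel: "N = B' * (B * N)" if "N \<in> carrier_mat r r" for N
    using assoc_mult_mat[OF car(3,1) that] BB that by simp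
  have "matrix_rep r \<rho>"
    unfolding matrix_rep_def
  proof (intro conjI ballI \<rho>car)
    show "\<rho> \<one> = 1\<^sub>m r" using rep(1) car CC by (simp add: \<rho>_def)
    fix g h assume g: "g \<in> carrier G" and h: "h \<in> carrier G"
    have "B * (\<rho> g * \<rho> h) = \<sigma> g * (B * \<rho> h)"
      using assoc_mult_mat[OF car(1) \<rho>car[OF g] \<rho>car[OF h]]
        assoc_mult_mat[OF rep(2)[OF g] car(1) \<rho>car[OF h]] inter[OF g] by simp
    also have "\<dots> = \<sigma> (g \<otimes> h) * B"
      unfolding inter[OF h, symmetric] rep(3)[OF g h] using car rep(2)[OF g] rep(2)[OF h]
      by (simp add: assoc_mult_mat[of _ d d _ d _ r])
    also have "\<dots> = B * \<rho> (g \<otimes> h)" using inter g h by simp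
    finally show "\<rho> (g \<otimes> h) = \<rho> g * \<rho> h"
      using cancel[of "\<rho> (g \<otimes> h)"] cancel[OF mult_carrier_mat[OF \<rho>car[OF g] \<rho>car[OF h]]] \<rho>car g h
      by simp
  qed auto
  from min[rule_format, OF \<open>r < d\<close> this] have 0: "fourier r c \<rho> = 0\<^sub>m r r" .
  have "fourier d c \<sigma> * B = weighted_sum (carrier G) d r c (\<lambda>g. \<sigma> g * B)"
    unfolding fourier_def by (rule weighted_sum_mult_right) (use rep car in auto)
  also have "\<dots> = weighted_sum (carrier G) d r c (\<lambda>g. B * \<rho> g)"
    using inter by (rule weighted_sum_cong)
  also have "\<dots> = B * fourier r c \<rho>"
    unfolding fourier_def by (rule weighted_sum_mult_left[symmetric]) (use \<rho>car car in auto)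
  finally have "fourier d c \<sigma> * B = 0\<^sub>m d r" using 0 car by simp
  then show ?thesis unfolding SBC using car assoc_mult_mat[OF _ car(1,2), of "fourier d c \<sigma>" d] by simp
qed

text \<open>Irreducibility is replaced by minimality of \<open>d\<close> among the representations
  that detect \<open>c\<close>. Subtracting an eigenvalue from \<open>T\<close> gives a singular
  commuting \<open>S\<close>. If \<open>S\<close> were nonzero, a commuting idempotent
  \<open>E\<close> would exist with \<open>E\<close> and \<open>1 - E\<close> both singular. The
  Fourier transform would be annihilated by both, hence by their sum, which is the identity.\<close>

lemma schur_of_minimal:
  assumes \<sigma>: "matrix_rep d \<sigma>" and ne: "fourier d c \<sigma> \<noteq> 0\<^sub>m d d"
    and min: "\<forall>r<d. \<forall>\<rho>. matrix_rep r \<rho> \<longrightarrow> fourier r c \<rho> = 0\<^sub>m r r"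
    and T: "T \<in> carrier_mat d d" "\<forall>g\<in>carrier G. \<sigma> g * T = T * \<sigma> g"
  obtains t where "T = t \<cdot>\<^sub>m 1\<^sub>m d"
proof -
  \<comment> \<open>All matrices of size zero are equal, so a nonzero transform forces a positive
    dimension, in which \<open>T\<close> has an eigenvalue.\<close>
  have d: "0 < d" using ne by (cases d) (auto simp: mat_eq_iff carrier_matD[OF fourier_carrier])
  note rep = matrix_repD[OF \<sigma>]
  note [simp] = assoc_mult_mat[of _ d d _ d _ d] mult_carrier_mat[of _ d d _ d]
  note kill = fourier_mult_commuting_singular[OF \<sigma> min]
  obtain t where "eigenvalue T t"
    using spectrum_non_empty[OF T(1) d] by (auto simp: spectrum_def)
  then obtain v where v: "v \<in> carrier_vec d" "v \<noteq> 0\<^sub>v d" "char_matrix T t *\<^sub>v v = 0\<^sub>v d"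
    unfolding eigenvalue_char_matrix[OF T(1)] by blast
  define S where "S = char_matrix T t"
  have S: "S \<in> carrier_mat d d" using T(1) by (simp add: S_def)
  have Sv: "S *\<^sub>v v = 0\<^sub>v d" using v(3) by (simp add: S_def)
  have comm: "\<sigma> g * S = S * \<sigma> g" if "g \<in> carrier G" for g
    unfolding S_def char_matrix_def using T(1) T(2)[rule_format, OF that] rep(2)[OF that]
    by (simp add: mult_add_distrib_mat[of _ d d] add_mult_distrib_mat[of _ d d]
        mult_smult_distrib[of _ d d _ d] mult_smult_assoc_mat[of _ d d _ d])
  have "S = 0\<^sub>m d d"
  proof (rule ccontr)
    assume S0: "S \<noteq> 0\<^sub>m d d"
    obtain r B C B' C' where car: "B \<in> carrier_mat d r" "C \<in> carrier_mat r d"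
        "B' \<in> carrier_mat r d" "C' \<in> carrier_mat d r"
      and SBC: "S = B * C" and BB: "B' * B = 1\<^sub>m r" and CC: "C * C' = 1\<^sub>m r"
      by (rule full_rank_factorization[OF S]) (rule that, assumption+)
    \<comment> \<open>Maschke: averaging a generalized inverse of \<open>S\<close> makes it commute with \<open>\<sigma>\<close>,
      which yields a commuting idempotent \<open>E\<close> with both \<open>E\<close> and \<open>1 - E\<close> singular.\<close>
    define Y where "Y = C' * B'"
    have Y: "Y \<in> carrier_mat d d" using car by (simp add: Y_def)
    have "S * Y * S = B * (C * C') * (B' * B) * C"
      unfolding SBC Y_def using car
      by (simp add: assoc_mult_mat[of _ d r _ d _ d] assoc_mult_mat[of _ d d _ r _ d]
          assoc_mult_mat[of _ d r _ r _ d] assoc_mult_mat[of _ d d _ d _ d]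
          assoc_mult_mat[of _ r d _ d _ d] assoc_mult_mat[of _ r d _ r _ d]
          mult_carrier_mat[of _ d r _ d] mult_carrier_mat[of _ r d _ r] mult_carrier_mat[of _ d r _ r]
          mult_carrier_mat[of _ d d _ d] mult_carrier_mat[of _ r d _ d] mult_carrier_mat[of _ d d _ r])
    then have SYS: "S * Y * S = S" using BB CC car SBC by simp
    let ?Y = "avg d \<sigma> Y"
    \<comment> \<open>In each summand the outer factors \<open>S\<close> move inwards past
      \<open>\<sigma> u\<close> and \<open>\<sigma> (inv u)\<close>, so that
      \<open>S * Y * S = S\<close> applies and the two group factors cancel.\<close>
    have SYS': "S * ?Y * S = S"
    proof -
      let ?w = "weighted_sum (carrier G) d d (\<lambda>_. 1 / of_nat (card (carrier G)))"
      have "S * ?Y * S = ?w (\<lambda>u. S * (\<sigma> u * Y * \<sigma> (inv u)) * S)"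
        unfolding avg_def using S Y rep(2)
        by (simp add: weighted_sum_mult_left[of _ _ d d] weighted_sum_mult_right[of _ _ d d]
            mult_carrier_mat[of _ d d _ d])
      also have "\<dots> = ?w (\<lambda>_. S)"
      proof (rule weighted_sum_cong)
        fix u assume u: "u \<in> carrier G"
        have "S * (\<sigma> u * Y * \<sigma> (inv u)) * S = (S * \<sigma> u) * Y * (\<sigma> (inv u) * S)"
          using S Y rep(2) u by simp
        also have "\<dots> = (\<sigma> u * S) * Y * (S * \<sigma> (inv u))"
          using comm[OF u] comm[of "inv u"] u by simp
        also have "\<dots> = \<sigma> u * (S * Y * S) * \<sigma> (inv u)"
          using S Y rep(2) u by simp
        also have "\<dots> = S * (\<sigma> u * \<sigma> (inv u))"
          unfolding SYS comm[OF u] using S rep(2) u by simp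
        finally show "S * (\<sigma> u * Y * \<sigma> (inv u)) * S = S" using rep(4)[OF u] S by simp
      qed
      also have "\<dots> = S"
        by (rule eq_matI) (use S card_carrier_nonzero in \<open>auto simp: weighted_sum_def\<close>)
      finally show ?thesis .
    qed
    define E where "E = ?Y * S"
    have E: "E \<in> carrier_mat d d" using S by (simp add: E_def)
    have SE: "S * E = S" unfolding E_def using SYS' S by simp
    have EE: "E * E = E"
      using SE S unfolding E_def by simp
    have Ecomm: "\<sigma> g * E = E * \<sigma> g" if "g \<in> carrier G" for g
    proof -
      have "\<sigma> g * E = (\<sigma> g * ?Y) * S"
        unfolding E_def using S rep(2)[OF that] by simp
      also have "\<dots> = ?Y * (\<sigma> g * S)"
        unfolding avg_commute[OF \<sigma> Y that] using S rep(2)[OF that]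
        by simp
      also have "\<dots> = E * \<sigma> g"
        unfolding comm[OF that] E_def using S rep(2)[OF that]
        by simp
      finally show ?thesis .
    qed
    have FE: "fourier d c \<sigma> * E = 0\<^sub>m d d"
    proof (rule kill[OF E _ v(1,2)])
      show "\<forall>g\<in>carrier G. \<sigma> g * E = E * \<sigma> g" using Ecomm by blast
      show "E *\<^sub>v v = 0\<^sub>v d"
        unfolding E_def assoc_mult_mat_vec[OF avg_carrier S v(1)] Sv
        by (rule eq_vecI) (auto simp: carrier_matD[OF avg_carrier])
    qed
    have "E \<noteq> 0\<^sub>m d d" using SE S S0 by auto
    then obtain i j where ij: "i < d" "j < d" "E $$ (i, j) \<noteq> 0" using E by (auto simp: mat_eq_iff)
    \<comment> \<open>A nonzero column of the idempotent \<open>E\<close> is fixed by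
      \<open>E\<close>, so it is a kernel vector of \<open>1 - E\<close>.\<close>
    define w where "w = col E j"
    have w: "w \<in> carrier_vec d" "w \<noteq> 0\<^sub>v d" using ij E by (auto simp: w_def vec_eq_iff)
    have Ew: "E *\<^sub>v w = w"
      unfolding w_def using EE E ij(2) by (metis carrier_matD(2) col_mult2)
    let ?E = "1\<^sub>m d - E"
    have "fourier d c \<sigma> * ?E = 0\<^sub>m d d"
    proof (rule kill[OF _ _ w])
      show "?E \<in> carrier_mat d d" using E by (simp add: minus_carrier_mat)
      show "?E *\<^sub>v w = 0\<^sub>v d" 
        using minus_mult_distrib_mat_vec[OF one_carrier_mat E w(1)] w Ew by simp
      have "\<sigma> g * ?E = ?E * \<sigma> g" if "g \<in> carrier G" for g
        using E Ecomm[OF that] rep(2)[OF that]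
        by (simp add: mult_minus_distrib_mat[of _ d d _ d] minus_mult_distrib_mat[of _ d d _ _ d])
      then show "\<forall>g\<in>carrier G. \<sigma> g * ?E = ?E * \<sigma> g" by blast
    qed
    then have "fourier d c \<sigma> - fourier d c \<sigma> * E = 0\<^sub>m d d"
      using E by (simp add: mult_minus_distrib_mat[of _ d d _ d] right_mult_one_mat[of _ d d])
    then show False using FE ne by (auto simp: mat_eq_iff carrier_matD[OF fourier_carrier])
  qed
  then have "T = t \<cdot>\<^sub>m 1\<^sub>m d"
    using T(1) unfolding S_def char_matrix_def mat_eq_iff by auto
  then show thesis by (rule that)
qed

text \<open>The regular representation detects every nonzero function, so a least detecting
  dimension exists, and \<open>schur_of_minimal\<close> applies there.\<close>

lemma exists_schur_rep_detecting:
  assumes h: "h \<in> carrier G" "c h \<noteq> 0"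
  obtains d \<sigma> where "matrix_rep d \<sigma>" "fourier d c \<sigma> \<noteq> 0\<^sub>m d d"
    "\<forall>T\<in>carrier_mat d d. (\<forall>g\<in>carrier G. \<sigma> g * T = T * \<sigma> g) \<longrightarrow> (\<exists>t. T = t \<cdot>\<^sub>m 1\<^sub>m d)"
proof -
  define P where "P d \<longleftrightarrow> (\<exists>\<sigma>. matrix_rep d \<sigma> \<and> fourier d c \<sigma> \<noteq> 0\<^sub>m d d)" for d
  let ?n = "card (carrier G)"
  obtain e where e: "bij_betw e {0..<?n} (carrier G)"
    using ex_bij_betw_nat_finite[OF finite_carrier] by blast
  have eG: "e i \<in> carrier G" if "i < ?n" for i using bij_betwE[OF e] that by simp
  have inj: "e i = e j \<longleftrightarrow> i = j" if "i < ?n" "j < ?n" for i j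
    using inj_on_eq_iff[OF bij_betw_imp_inj_on[OF e]] that by simp
  have surj: "\<exists>i<?n. e i = g" if "g \<in> carrier G" for g
  proof -
    have "g \<in> e ` {0..<?n}" using bij_betw_imp_surj_on[OF e] that by simp
    then show ?thesis by auto
  qed
  \<comment> \<open>The left regular representation, in the basis of group elements enumerated by
    \<open>e\<close>.\<close>
  define R where "R g = mat ?n ?n (\<lambda>(i, j). of_bool (e i = g \<otimes> e j) :: complex)" for g
  have "matrix_rep ?n R"
    unfolding matrix_rep_def
  proof (intro conjI ballI)
    show "R \<one> = 1\<^sub>m ?n"
      by (rule eq_matI) (auto simp: R_def eG inj)
    show "R g \<in> carrier_mat ?n ?n" for g by (simp add: R_def)
    fix g k assume g: "g \<in> carrier G" and k: "k \<in> carrier G"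
    show "R (g \<otimes> k) = R g * R k"
    proof (rule eq_matI)
      fix i j assume "i < dim_row (R g * R k)" "j < dim_col (R g * R k)"
      then have i: "i < ?n" and j: "j < ?n" by (auto simp: R_def)
      obtain m where m: "m < ?n" "e m = k \<otimes> e j" using surj[of "k \<otimes> e j"] k eG[OF j] by auto
      have "(R g * R k) $$ (i, j)
          = (\<Sum>l\<in>{0..<?n}. of_bool (e i = g \<otimes> e l) * of_bool (e l = k \<otimes> e j))"
        using i j by (simp add: R_def scalar_prod_def)
      also have "\<dots> = (\<Sum>l\<in>{0..<?n}. if l = m then of_bool (e i = g \<otimes> e m) else 0)"
        by (rule sum.cong) (auto simp: m(2)[symmetric] inj m(1))
      also have "\<dots> = R (g \<otimes> k) $$ (i, j)"
        using i j m g k eG[OF j] by (simp add: R_def m_assoc)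
      finally show "R (g \<otimes> k) $$ (i, j) = (R g * R k) $$ (i, j)" ..
    qed (auto simp: R_def)
  qed
  moreover have "fourier ?n c R \<noteq> 0\<^sub>m ?n ?n"
  proof -
    \<comment> \<open>In row \<open>h\<close> and column \<open>\<one>\<close>, only
      \<open>R h\<close> has a nonzero entry, so this entry of the transform is
      \<open>c h\<close>.\<close>
    obtain i j where i: "i < ?n" "e i = h" and j: "j < ?n" "e j = \<one>" using surj h by blast
    have "fourier ?n c R $$ (i, j) = (\<Sum>x\<in>carrier G. c x * R x $$ (i, j))"
      using i j by (simp add: fourier_def weighted_sum_index)
    also have "\<dots> = (\<Sum>x\<in>carrier G. if x = h then c h else 0)"
      by (rule sum.cong) (use i j in \<open>auto simp: R_def\<close>)
    also have "\<dots> = c h" using h finite_carrier by simp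
    finally show ?thesis using h i j by auto
  qed
  ultimately have "P ?n" unfolding P_def by blast
  define d where "d = (LEAST d. P d)"
  have "P d" unfolding d_def by (rule LeastI[of P, OF \<open>P ?n\<close>])
  then obtain \<sigma> where \<sigma>: "matrix_rep d \<sigma>" "fourier d c \<sigma> \<noteq> 0\<^sub>m d d" unfolding P_def by blast
  have "\<forall>r<d. \<forall>\<rho>. matrix_rep r \<rho> \<longrightarrow> fourier r c \<rho> = 0\<^sub>m r r"
    using not_less_Least[of _ P] unfolding d_def P_def by blast
  note schur = schur_of_minimal[OF \<sigma> this]
  have "\<forall>T\<in>carrier_mat d d. (\<forall>g\<in>carrier G. \<sigma> g * T = T * \<sigma> g) \<longrightarrow> (\<exists>t. T = t \<cdot>\<^sub>m 1\<^sub>m d)"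
    using schur by blast
  from that[OF \<sigma> this] show thesis .
qed

section \<open>Orthogonality of matrix coefficients\<close>

lemma matrix_rep_mult_index:
  assumes "matrix_rep d \<sigma>" "g \<in> carrier G" "h \<in> carrier G" "i < d" "j < d"
  shows "\<sigma> (g \<otimes> h) $$ (i, j) = (\<Sum>k<d. \<sigma> g $$ (i, k) * \<sigma> h $$ (k, j))"
  using matrix_repD(2)[OF assms(1,2)] matrix_repD(2)[OF assms(1,3)] assms(4,5)
  by (simp add: matrix_repD(3)[OF assms(1-3)] scalar_prod_def atLeast0LessThan)

text \<open>Average the matrix unit \<open>X\<close> at position \<open>(j, k)\<close>: the entries
  of the average are the sums in question divided by the group order. By the Schur property the
  average is a scalar \<open>t\<close>, which its trace determines. With \<open>inv u\<close> in
  place of complex conjugation, \<open>\<sigma>\<close> need not be unitary.\<close>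

lemma schur_orthogonality:
  assumes \<sigma>: "matrix_rep d \<sigma>"
    and schur: "\<forall>T\<in>carrier_mat d d. (\<forall>g\<in>carrier G. \<sigma> g * T = T * \<sigma> g) \<longrightarrow> (\<exists>t. T = t \<cdot>\<^sub>m 1\<^sub>m d)"
    and i: "i < d" and j: "j < d" and k: "k < d" and l: "l < d"
  shows "(\<Sum>u\<in>carrier G. \<sigma> u $$ (i, j) * \<sigma> (inv u) $$ (k, l))
    = of_bool (i = l \<and> j = k) * of_nat (card (carrier G)) / of_nat d"
proof -
  let ?n = "of_nat (card (carrier G)) :: complex"
  note rep = matrix_repD[OF \<sigma>]
  have n: "?n \<noteq> 0" using card_carrier_nonzero by simp
  define X where "X = mat d d (\<lambda>(a, b). of_bool (a = j \<and> b = k) :: complex)"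
  have X: "X \<in> carrier_mat d d" by (simp add: X_def)
  have entry: "(\<sigma> u * X * \<sigma> (inv u)) $$ (a, b) = \<sigma> u $$ (a, j) * \<sigma> (inv u) $$ (k, b)"
    if u: "u \<in> carrier G" and a: "a < d" and b: "b < d" for u a b
  proof -
    have uX: "(\<sigma> u * X) $$ (a, b) = (if b = k then \<sigma> u $$ (a, j) else 0)" if "b < d" for b
    proof -
      have "(\<sigma> u * X) $$ (a, b) = (\<Sum>m = 0..<d. \<sigma> u $$ (a, m) * X $$ (m, b))"
        using rep(2)[OF u] a that by (simp add: scalar_prod_def X_def)
      also have "\<dots> = (\<Sum>m = 0..<d. if m = j then (if b = k then \<sigma> u $$ (a, j) else 0) else 0)"
        by (rule sum.cong) (use that in \<open>auto simp: X_def\<close>)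
      finally show ?thesis using j by simp
    qed
    have "(\<sigma> u * X * \<sigma> (inv u)) $$ (a, b) = (\<Sum>m = 0..<d. (\<sigma> u * X) $$ (a, m) * \<sigma> (inv u) $$ (m, b))"
      using rep(2)[OF u] rep(2)[of "inv u"] u a b X
      by (simp add: scalar_prod_def del: assoc_mult_mat)
    also have "\<dots> = (\<Sum>m = 0..<d. if m = k then \<sigma> u $$ (a, j) * \<sigma> (inv u) $$ (k, b) else 0)"
      by (rule sum.cong) (auto simp: uX)
    finally show ?thesis using k by simp
  qed
  have avg: "avg d \<sigma> X $$ (a, b) = (\<Sum>u\<in>carrier G. \<sigma> u $$ (a, j) * \<sigma> (inv u) $$ (k, b)) / ?n"
    if "a < d" "b < d" for a b
    unfolding avg_def using that entry
    by (simp add: weighted_sum_index sum_divide_distrib)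
  obtain t where t: "avg d \<sigma> X = t \<cdot>\<^sub>m 1\<^sub>m d"
    using schur avg_commute[OF \<sigma> X] by (meson avg_carrier)
  \<comment> \<open>In the trace, summing over \<open>a\<close> multiplies
    \<open>\<sigma> (inv u)\<close> by \<open>\<sigma> u\<close>, leaving an entry of the identity
    matrix.\<close>
  have "of_nat d * t = (\<Sum>a<d. avg d \<sigma> X $$ (a, a))" by (simp add: t)
  also have "\<dots> = (\<Sum>a<d. \<Sum>u\<in>carrier G. \<sigma> (inv u) $$ (k, a) * \<sigma> u $$ (a, j)) / ?n"
    by (simp add: avg sum_divide_distrib mult.commute)
  also have "\<dots> = (\<Sum>u\<in>carrier G. \<sigma> (inv u \<otimes> u) $$ (k, j)) / ?n"
    by (subst sum.swap) (simp add: matrix_rep_mult_index[OF \<sigma> _ _ k j] del: l_inv Units_l_inv)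
  also have "\<dots> = of_bool (j = k)" using n j k rep(1) by simp
  finally have "t = of_bool (j = k) / of_nat d" using i by (simp add: field_simps)
  moreover have "(\<Sum>u\<in>carrier G. \<sigma> u $$ (i, j) * \<sigma> (inv u) $$ (k, l)) = t * of_bool (i = l) * ?n"
    using avg[OF i l] t i l n by (auto simp: field_simps)
  ultimately show ?thesis by auto
qed

section \<open>Eigenvalues of \<open>A\<close> and representation dimensions\<close>

lemma eigenvalue_rep_dimension:
  fixes f :: "'a \<Rightarrow> 'a \<Rightarrow> complex"
  assumes \<mu>: "\<mu> \<noteq> 0"
    and eig: "\<And>x y. x \<in> carrier G \<Longrightarrow> y \<in> carrier G \<Longrightarrow>
      (\<Sum>u\<in>carrier G. f (x \<otimes> u) (u \<otimes> y)) = of_nat (card (carrier G)) * \<mu> * f x y"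
    and total: "(\<Sum>x\<in>carrier G. \<Sum>y\<in>carrier G. f x y) = 0"
    and xy: "x0 \<in> carrier G" "y0 \<in> carrier G" "f x0 y0 \<noteq> 0"
  obtains d \<sigma> where "matrix_rep d \<sigma>" "\<exists>g\<in>carrier G. \<sigma> g \<noteq> 1\<^sub>m d" "of_nat d * cmod \<mu> = 1"
proof -
  let ?n = "of_nat (card (carrier G)) :: complex"
  have n: "?n \<noteq> 0" using card_carrier_nonzero by simp
  obtain d \<sigma> where \<sigma>: "matrix_rep d \<sigma>" and ne: "fourier d (\<lambda>x. f x y0) \<sigma> \<noteq> 0\<^sub>m d d"
    and schur: "\<forall>T\<in>carrier_mat d d. (\<forall>g\<in>carrier G. \<sigma> g * T = T * \<sigma> g) \<longrightarrow> (\<exists>t. T = t \<cdot>\<^sub>m 1\<^sub>m d)"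
    using exists_schur_rep_detecting[of x0 "\<lambda>x. f x y0"] xy by blast
  note mult = matrix_rep_mult_index[OF \<sigma>]
  \<comment> \<open>\<open>F y\<close> is the Fourier transform of \<open>f\<close> in its first
    variable; \<open>B\<close> collects the transforms of its entries in the second variable, taken
    against \<open>\<sigma> (inv v)\<close>.\<close>
  define F where "F y i j = (\<Sum>x\<in>carrier G. f x y * \<sigma> x $$ (i, j))" for y i j
  define B where "B i k l j = (\<Sum>v\<in>carrier G. F v i k * \<sigma> (inv v) $$ (l, j))" for i k l j
  obtain i j where i: "i < d" and j: "j < d" and F0: "F y0 i j \<noteq> 0"
    using ne by (auto simp: mat_eq_iff fourier_def weighted_sum_def F_def)
  \<comment> \<open>Translating \<open>x\<close> by \<open>u\<close> splits off
    \<open>\<sigma> (inv u)\<close>. With \<open>v = u \<otimes> y\<close> one has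
    \<open>inv u = y \<otimes> inv v\<close>, so the dependence on \<open>y\<close> is confined to
    the factor \<open>\<sigma> y\<close>.\<close>
  have FB: "?n * \<mu> * F y i j = (\<Sum>k<d. \<Sum>l<d. B i k l j * \<sigma> y $$ (k, l))"
    if i: "i < d" and j: "j < d" and y: "y \<in> carrier G" for i j y
  proof -
    have "?n * \<mu> * F y i j = (\<Sum>x\<in>carrier G. (\<Sum>u\<in>carrier G. f (x \<otimes> u) (u \<otimes> y)) * \<sigma> x $$ (i, j))"
      unfolding F_def sum_distrib_left by (rule sum.cong) (simp_all add: eig y)
    also have "\<dots> = (\<Sum>u\<in>carrier G. \<Sum>x\<in>carrier G. f (x \<otimes> u) (u \<otimes> y) * \<sigma> x $$ (i, j))"
      unfolding sum_distrib_right by (rule sum.swap)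
    also have "\<dots> = (\<Sum>u\<in>carrier G. \<Sum>k<d. F (u \<otimes> y) i k * \<sigma> (inv u) $$ (k, j))"
    proof (rule sum.cong[OF refl])
      fix u assume u: "u \<in> carrier G"
      have "(\<Sum>x\<in>carrier G. f (x \<otimes> u) (u \<otimes> y) * \<sigma> x $$ (i, j))
          = (\<Sum>x\<in>carrier G. f (x \<otimes> u) (u \<otimes> y) * \<sigma> (x \<otimes> u \<otimes> inv u) $$ (i, j))"
        by (rule sum.cong) (simp_all add: u m_assoc)
      also have "\<dots> = (\<Sum>x\<in>carrier G. f x (u \<otimes> y) * \<sigma> (x \<otimes> inv u) $$ (i, j))"
        by (rule sum_carrier_right_translate[OF u, where f = "\<lambda>x. f x (u \<otimes> y) * \<sigma> (x \<otimes> inv u) $$ (i, j)"])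
      also have "\<dots> = (\<Sum>x\<in>carrier G. \<Sum>k<d. f x (u \<otimes> y) * \<sigma> x $$ (i, k) * \<sigma> (inv u) $$ (k, j))"
        by (rule sum.cong) (simp_all add: u mult i j sum_distrib_left mult.assoc)
      also have "\<dots> = (\<Sum>k<d. F (u \<otimes> y) i k * \<sigma> (inv u) $$ (k, j))"
        unfolding F_def sum_distrib_right by (rule sum.swap)
      finally show "(\<Sum>x\<in>carrier G. f (x \<otimes> u) (u \<otimes> y) * \<sigma> x $$ (i, j))
          = (\<Sum>k<d. F (u \<otimes> y) i k * \<sigma> (inv u) $$ (k, j))" .
    qed
    also have "\<dots> = (\<Sum>u\<in>carrier G. \<Sum>k<d. F (u \<otimes> y) i k * \<sigma> (y \<otimes> inv (u \<otimes> y)) $$ (k, j))"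
      using y by (intro sum.cong refl) (simp add: inv_mult_group m_assoc[symmetric])
    also have "\<dots> = (\<Sum>v\<in>carrier G. \<Sum>k<d. F v i k * \<sigma> (y \<otimes> inv v) $$ (k, j))"
      by (rule sum_carrier_right_translate[OF y, where f = "\<lambda>v. \<Sum>k<d. F v i k * \<sigma> (y \<otimes> inv v) $$ (k, j)"])
    also have "\<dots> = (\<Sum>v\<in>carrier G. \<Sum>k<d. \<Sum>l<d. F v i k * \<sigma> (inv v) $$ (l, j) * \<sigma> y $$ (k, l))"
      by (intro sum.cong refl) (simp add: y mult j sum_distrib_left mult_ac)
    also have "\<dots> = (\<Sum>k<d. \<Sum>l<d. B i k l j * \<sigma> y $$ (k, l))"
      unfolding B_def sum_distrib_right by (subst sum.swap, rule sum.cong[OF refl], rule sum.swap)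
    finally show ?thesis .
  qed
  \<comment> \<open>Inserting \<open>FB\<close> into the definition of \<open>B\<close>, orthogonality swaps the inner indices up to the
    factor \<open>1 / (\<mu> d)\<close>, so applying this twice gives \<open>(\<mu> d)\<^sup>2 = 1\<close>.\<close>
  have BB: "\<mu> * of_nat d * B i k l j = B i j l k"
    if i: "i < d" and j: "j < d" and k: "k < d" and l: "l < d" for i j k l
  proof -
    have "?n * \<mu> * B i k l j = (\<Sum>v\<in>carrier G. (?n * \<mu> * F v i k) * \<sigma> (inv v) $$ (l, j))"
      unfolding B_def by (simp add: sum_distrib_left mult.assoc)
    also have "\<dots> = (\<Sum>v\<in>carrier G. \<Sum>p<d. \<Sum>q<d. B i p q k * (\<sigma> v $$ (p, q) * \<sigma> (inv v) $$ (l, j)))"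
      by (rule sum.cong[OF refl], subst FB[OF i k])
         (simp_all add: sum_distrib_right mult.assoc)
    also have "\<dots> = (\<Sum>p<d. \<Sum>q<d. B i p q k * (\<Sum>v\<in>carrier G. \<sigma> v $$ (p, q) * \<sigma> (inv v) $$ (l, j)))"
      unfolding sum_distrib_left by (subst sum.swap, rule sum.cong[OF refl], rule sum.swap)
    also have "\<dots> = (\<Sum>p<d. \<Sum>q<d. if p = j then if q = l then B i j l k * (?n / of_nat d) else 0 else 0)"
      by (intro sum.cong refl) (auto simp: schur_orthogonality[OF \<sigma> schur] l j)
    also have "\<dots> = (\<Sum>p<d. if p = j then B i j l k * (?n / of_nat d) else 0)"
      by (intro sum.cong refl) (simp add: l)
    also have "\<dots> = B i j l k * (?n / of_nat d)" using j by simp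
    finally show ?thesis using n i by (simp add: field_simps)
  qed
  have "\<exists>k<d. \<exists>l<d. B i k l j \<noteq> 0"
  proof (rule ccontr)
    assume "\<not> ?thesis"
    then have "(\<Sum>k<d. \<Sum>l<d. B i k l j * \<sigma> y0 $$ (k, l)) = 0" by (intro sum.neutral ballI) auto
    then show False using FB[OF i j xy(2)] F0 \<mu> n by simp
  qed
  then obtain k l where k: "k < d" and l: "l < d" and B0: "B i k l j \<noteq> 0" by blast
  have "(\<mu> * of_nat d) * ((\<mu> * of_nat d) * B i k l j) = B i k l j"
    using BB[OF i j k l] BB[OF i k j l] by simp
  then have "(\<mu> * of_nat d)\<^sup>2 = 1" using B0 by (simp add: power2_eq_square mult.assoc[symmetric])
  then have "cmod (\<mu> * of_nat d) = 1" by (auto simp: power2_eq_1_iff norm_minus_cancel)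
  then have 1: "of_nat d * cmod \<mu> = 1" by (simp add: norm_mult mult.commute)
  \<comment> \<open>For trivial \<open>\<sigma>\<close>, \<open>F y0\<close> is the sum of
    \<open>f x y0\<close> over \<open>x\<close> times the identity. Summing the eigenvalue equation
    over \<open>x\<close> makes that sum a multiple of the total sum of \<open>f\<close>, which is
    zero.\<close>
  have "\<exists>g\<in>carrier G. \<sigma> g \<noteq> 1\<^sub>m d"
  proof (rule ccontr)
    assume "\<not> ?thesis"
    then have triv: "\<sigma> g = 1\<^sub>m d" if "g \<in> carrier G" for g using that by blast
    have "?n * \<mu> * (\<Sum>x\<in>carrier G. f x y0) = (\<Sum>x\<in>carrier G. \<Sum>u\<in>carrier G. f (x \<otimes> u) (u \<otimes> y0))"
      unfolding sum_distrib_left by (rule sum.cong) (simp_all add: eig xy)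
    also have "\<dots> = (\<Sum>u\<in>carrier G. \<Sum>x\<in>carrier G. f (x \<otimes> u) (u \<otimes> y0))" by (rule sum.swap)
    also have "\<dots> = (\<Sum>u\<in>carrier G. \<Sum>x\<in>carrier G. f x (u \<otimes> y0))"
      by (intro sum.cong refl sum_carrier_right_translate[where f = "\<lambda>x. f x _"])
    also have "\<dots> = (\<Sum>u\<in>carrier G. \<Sum>x\<in>carrier G. f x u)"
      by (rule sum_carrier_right_translate[OF xy(2), where f = "\<lambda>u. \<Sum>x\<in>carrier G. f x u"])
    also have "\<dots> = 0" using total by (subst sum.swap)
    finally have "(\<Sum>x\<in>carrier G. f x y0) = 0" using n \<mu> by simp
    moreover have "F y0 i j = (\<Sum>x\<in>carrier G. f x y0) * 1\<^sub>m d $$ (i, j)"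
      unfolding F_def sum_distrib_right by (rule sum.cong) (simp_all add: triv)
    ultimately show False using F0 by simp
  qed
  from that[OF \<sigma> this 1] show thesis .
qed

section \<open>The multiplication table and its spectral radius\<close>

lemma matrix_rep_nontrivial_rep:
  assumes "matrix_rep d \<sigma>" "\<exists>g\<in>carrier G. \<sigma> g \<noteq> 1\<^sub>m d"
  shows "nontrivial_rep G d \<sigma>"
proof -
  have "\<sigma> g \<in> Units (ring_mat TYPE(complex) d ())" if "g \<in> carrier G" for g
    unfolding Units_def ring_mat_def
    using matrix_repD(2)[OF assms(1)] matrix_repD(4,5)[OF assms(1) that] that
    by (auto intro!: bexI[of _ "\<sigma> (inv g)"])
  then show ?thesis
    using assms matrix_repD(3)[OF assms(1)]
    by (auto simp: nontrivial_rep_def hom_def complex_GL_def units_of_def ring_mat_def)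
qed

lemma latin_square_mult_table:
  "latin_square (card (carrier G)) (carrier G) (carrier G) (carrier G) (mult_table G)"
  unfolding latin_square_def
proof (intro conjI ballI)
  show "\<exists>!x. (x, y, z) \<in> mult_table G" if "y \<in> carrier G" "z \<in> carrier G" for y z
    by (rule ex1I[of _ "z \<otimes> inv y"]) (use that in \<open>auto simp: mult_table_def m_assoc\<close>)
  show "\<exists>!y. (x, y, z) \<in> mult_table G" if "z \<in> carrier G" "x \<in> carrier G" for x z
    by (rule ex1I[of _ "inv x \<otimes> z"]) (use that in \<open>auto simp: mult_table_def m_assoc[symmetric]\<close>)
qed (auto simp: finite_carrier mult_table_def)

lemma op_A_mult_table:
  assumes "x \<in> carrier G" "y \<in> carrier G"
  shows "op_A (card (carrier G)) (carrier G) (mult_table G) f (x, y)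
    = (\<Sum>u\<in>carrier G. f (x \<otimes> u, u \<otimes> y)) / of_nat (card (carrier G))"
proof -
  have "(\<Sum>z\<in>carrier G. f (THE x'. (x', y, z) \<in> mult_table G, THE y'. (x, y', z) \<in> mult_table G))
      = (\<Sum>z\<in>carrier G. f (z \<otimes> inv y, inv x \<otimes> z))"
  proof (rule sum.cong[OF refl])
    fix z assume z: "z \<in> carrier G"
    have "(THE x'. (x', y, z) \<in> mult_table G) = z \<otimes> inv y"
      by (rule the_equality) (use assms z in \<open>auto simp: mult_table_def m_assoc\<close>)
    moreover have "(THE y'. (x, y', z) \<in> mult_table G) = inv x \<otimes> z"
      by (rule the_equality) (use assms z in \<open>auto simp: mult_table_def m_assoc[symmetric]\<close>)
    ultimately show "f (THE x'. (x', y, z) \<in> mult_table G, THE y'. (x, y', z) \<in> mult_table G)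
        = f (z \<otimes> inv y, inv x \<otimes> z)" by simp
  qed
  also have "\<dots> = (\<Sum>u\<in>carrier G. f (x \<otimes> u, u \<otimes> y))"
  proof -
    have "x \<otimes> (inv x \<otimes> a) = a" "inv x \<otimes> (x \<otimes> a) = a" if "a \<in> carrier G" for a
      using that assms by (simp_all add: m_assoc[symmetric])
    then show ?thesis
      by (intro sum.reindex_bij_witness[of _ "\<lambda>u. x \<otimes> u \<otimes> y" "\<lambda>z. inv x \<otimes> z \<otimes> inv y"])
         (use assms in \<open>auto simp: m_assoc\<close>)
  qed
  finally show ?thesis by (simp add: op_A_def)
qed

lemma spectrum_norm_bound:
  assumes "\<mu> \<in> op_spectrum (carrier G \<times> carrier G)
    (\<lambda>f p. op_A (card (carrier G)) (carrier G) (mult_table G) f p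
      - op_U (card (carrier G)) (carrier G) (carrier G) f p)"
  shows "cmod \<mu> \<le> 1 / real (min_nontrivial_rep_dim G)"
proof (cases "\<mu> = 0")
  case False
  let ?n = "of_nat (card (carrier G)) :: complex"
  have n: "?n \<noteq> 0" using card_carrier_nonzero by simp
  from assms obtain f x0 y0 where f0: "x0 \<in> carrier G" "y0 \<in> carrier G" "f (x0, y0) \<noteq> 0"
    and eq: "\<forall>p\<in>carrier G \<times> carrier G. op_A (card (carrier G)) (carrier G) (mult_table G) f p
      - op_U (card (carrier G)) (carrier G) (carrier G) f p = \<mu> * f p"
    unfolding op_spectrum_def by blast
  define s where "s = (\<Sum>x\<in>carrier G. \<Sum>y\<in>carrier G. f (x, y))"
  have ev: "(\<Sum>u\<in>carrier G. f (x \<otimes> u, u \<otimes> y)) / ?n - s / ?n\<^sup>2 = \<mu> * f (x, y)"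
    if "x \<in> carrier G" "y \<in> carrier G" for x y
    using eq[rule_format, of "(x, y)"] that by (simp add: op_A_mult_table op_U_def s_def)
  \<comment> \<open>Both averaging operators preserve the total sum \<open>s\<close>, so their
    difference has total sum zero; as \<open>\<mu>\<close> is nonzero, \<open>s = 0\<close> and the
    \<open>U\<close> term drops out of the eigenvalue equation.\<close>
  have "\<mu> * s = (\<Sum>x\<in>carrier G. \<Sum>y\<in>carrier G. (\<Sum>u\<in>carrier G. f (x \<otimes> u, u \<otimes> y)) / ?n - s / ?n\<^sup>2)"
    unfolding sum_distrib_left by (simp add: ev) (simp add: s_def sum_distrib_left)
  also have "\<dots> = (\<Sum>x\<in>carrier G. \<Sum>y\<in>carrier G. \<Sum>u\<in>carrier G. f (x \<otimes> u, u \<otimes> y)) / ?n - s"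
    using n by (simp add: sum_subtractf sum_divide_distrib power2_eq_square)
  also have "(\<Sum>x\<in>carrier G. \<Sum>y\<in>carrier G. \<Sum>u\<in>carrier G. f (x \<otimes> u, u \<otimes> y)) = ?n * s"
  proof -
    have "(\<Sum>x\<in>carrier G. \<Sum>y\<in>carrier G. \<Sum>u\<in>carrier G. f (x \<otimes> u, u \<otimes> y))
        = (\<Sum>x\<in>carrier G. \<Sum>u\<in>carrier G. \<Sum>y\<in>carrier G. f (x \<otimes> u, y))"
      by (rule sum.cong[OF refl], subst sum.swap, rule sum.cong[OF refl])
         (rule sum_carrier_left_translate)
    also have "\<dots> = (\<Sum>u\<in>carrier G. \<Sum>x\<in>carrier G. \<Sum>y\<in>carrier G. f (x, y))"
      by (subst sum.swap, rule sum.cong[OF refl])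
         (rule sum_carrier_right_translate[where f = "\<lambda>x. \<Sum>y\<in>carrier G. f (x, y)"])
    finally show ?thesis by (simp add: s_def)
  qed
  finally have s: "s = 0" using False n by simp
  obtain d \<sigma> where d: "matrix_rep d \<sigma>" "\<exists>g\<in>carrier G. \<sigma> g \<noteq> 1\<^sub>m d" "of_nat d * cmod \<mu> = 1"
  proof (rule eigenvalue_rep_dimension[of \<mu> "\<lambda>x y. f (x, y)" x0 y0])
    show "(\<Sum>u\<in>carrier G. f (x \<otimes> u, u \<otimes> y)) = ?n * \<mu> * f (x, y)"
      if "x \<in> carrier G" "y \<in> carrier G" for x y
      using ev[OF that] n by (simp add: s field_simps)
  qed (use False f0 s in \<open>auto simp: s_def\<close>)
  have rep: "nontrivial_rep G d \<sigma>" using matrix_rep_nontrivial_rep d by blast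
  let ?D = "min_nontrivial_rep_dim G"
  have "?D \<le> d" unfolding min_nontrivial_rep_dim_def by (rule Least_le) (use rep in blast)
  \<comment> \<open>The minimum is attained because \<open>\<sigma>\<close> exists, and in dimension
    zero every representation is trivial. Positivity matters since \<open>1 / 0\<close> is
    \<open>0\<close>.\<close>
  moreover have "?D \<noteq> 0"
  proof
    have "\<exists>\<phi>. nontrivial_rep G ?D \<phi>"
      unfolding min_nontrivial_rep_dim_def by (rule LeastI_ex) (use rep in blast)
    moreover assume "?D = 0"
    ultimately show False
      by (auto simp: nontrivial_rep_def hom_def complex_GL_def units_of_def ring_mat_def
          Units_def Pi_iff mat_eq_iff)
  qed
  ultimately have "real ?D * cmod \<mu> \<le> 1" "0 < real ?D"
    using d(3) mult_right_mono[of "real ?D" "real d" "cmod \<mu>"] by auto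
  then show ?thesis by (simp add: field_simps)
qed simp

text \<open>Constants are fixed by both averaging operators. The spectrum is thus nonempty, as
  needed to bound its supremum by bounding each member.\<close>

lemma zero_in_spectrum:
  "0 \<in> op_spectrum (carrier G \<times> carrier G)
    (\<lambda>f p. op_A (card (carrier G)) (carrier G) (mult_table G) f p
      - op_U (card (carrier G)) (carrier G) (carrier G) f p)"
proof -
  have "card (carrier G) \<noteq> 0" "\<exists>x. x \<in> carrier G" using card_carrier_nonzero one_closed by blast+
  then show ?thesis
    unfolding op_spectrum_def
    by (auto intro!: exI[of _ "\<lambda>_. 1"] simp: op_A_mult_table op_U_def power2_eq_square)
qed

end

theorem theorem1p4:
  fixes G :: "('a, 'b) monoid_scheme"
  assumes "group G"
    and "finite (carrier G)"
    and "carrier G \<noteq> {\<one>\<^bsub>G\<^esub>}"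
  shows "A_quasirandom (card (carrier G)) (carrier G) (carrier G) (carrier G)
           (mult_table G) (1 / real (min_nontrivial_rep_dim G))"
proof -
  interpret finite_group G
    using assms by (simp add: finite_group_def finite_group_axioms_def)
  show ?thesis
    unfolding A_quasirandom_def op_spectral_radius_def
    using latin_square_mult_table zero_in_spectrum spectrum_norm_bound
    by (auto intro!: cSUP_least)
qed

end
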